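(* Let $f:\mathbb{R}^n\to\mathbb{R}$, $x^0\in\mathbb{R}^n$, and $Y=\{x^0\}\cup\{x^0+d^i:i=1,\ldots,m\}\subseteq\mathbb{R}^n$. Suppose that $Y$ lies in the $d$-dimensional affine space $\mathcal{Y}=\{x^0+Q\widehat{x}:\widehat{x}\in\mathbb{R}^d\}$, where $d<n$ and $Q\in\mathbb{R}^{n\times d}$ has $d$ orthonormal columns, and that there exists a quadratic function that interpolates $f$ on $Y$. Let $\widehat{d}^i\in\mathbb{R}^d$ be such that $d^i=Q\widehat{d}^i$, let $\widehat{Y}=\{0\}\cup\{\widehat{d}^i:i=1,\ldots,m\}\subseteq\mathbb{R}^d$, and let $\widehat{f}(\widehat{x})=f(x^0+Q\widehat{x})$ for $\widehat{x}\in\mathbb{R}^d$. Then: (1) Both $\nabla_{\mathrm{MFN}}^2f(x^0;Y)$ and $\nabla_{\mathrm{MFN}}^2\widehat{f}(0;\widehat{Y})$ exist and are unique, and satisfy $$\nabla_{\mathrm{MFN}}^2f(x^0;Y)=Q\nabla_{\mathrm{MFN}}^2\widehat{f}(0;\widehat{Y})Q^\top.$$ (2) The sets of gradient approximations satisfy $$\mathcal{G}_{\mathrm{MFN}}^{x^0,Y}=\left\{Q\alpha:\alpha\in\mathcal{G}_{\mathrm{MFN}}^{0,\widehat{Y}}\right\}+\mathrm{col}(Q)^\perp.$$ (3) For any pair $(\nabla_{\mathrm{MFN}}f(x^0;Y),\nabla_{\mathrm{MFN}}\widehat{f}(0;\widehat{Y}))\in\mathcal{G}_{\mathrm{MFN}}^{x^0,Y}\times\mathcal{G}_{\mathrm{MFN}}^{0,\widehat{Y}}$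 such that $\nabla_{\mathrm{MFN}}f(x^0;Y)-Q\nabla_{\mathrm{MFN}}\widehat{f}(0;\widehat{Y})\in\mathrm{col}(Q)^\perp$, the corresponding models satisfy $$m_{\mathrm{MFN}}^{x^0,Y}(x)=\widehat{m}_{\mathrm{MFN}}^{0,\widehat{Y}}(\widehat{x})\quad\text{for all }(x,\widehat{x})\in\mathbb{R}^n\times\mathbb{R}^d\text{ with }x=x^0+Q\widehat{x}.$$ (4) In particular, if $\nabla_{\mathrm{MFN}}f(x^0;Y)=Q\nabla_{\mathrm{MFN}}\widehat{f}(0;\widehat{Y})$, then $$m_{\mathrm{MFN}}^{x^0,Y}(x)=\widehat{m}_{\mathrm{MFN}}^{0,\widehat{Y}}(\widehat{x})\quad\text{for all }(x,\widehat{x})\in\mathbb{R}^n\times\mathbb{R}^d\text{ with }x\in(x^0+Q\widehat{x})+\mathrm{col}(Q)^\perp.$$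
   Context: $S_k(\mathbb{R})$ is the set of real symmetric $k\times k$ matrices; $\|\cdot\|_F$ is the Frobenius norm; $\mathrm{col}(Q)^\perp$ is the orthogonal complement of the column space of $Q$; the sum of two sets of vectors is the Minkowski sum. A quadratic function is a polynomial of degree at most 2. Minimum Frobenius norm (MFN) models. For a function $g:\mathbb{R}^k\to\mathbb{R}$, a point $z^0\in\mathbb{R}^k$ and a sample set $Z=\{z^0\}\cup\{z^0+u^i:i=1,\ldots,m\}\subseteq\mathbb{R}^k$, let $\mathcal{M}_{\mathrm{MFN}}^{z^0,Z}$ be the set of minimizers $(\alpha,H)$ of $$\min_{\alpha\in\mathbb{R}^k,\ H\in S_k(\mathbb{R})}\ \tfrac12\|H\|_F^2\quad\text{s.t. }(u^i)^\top\alpha+\tfrac12(u^i)^\top Hu^i=g(z^0+u^i)-g(z^0),\ i=1,\ldots,m.$$ An element of this set is denoted $(\nabla_{\mathrm{MFN}}g(z^0;Z),\nabla^2_{\mathrm{MFN}}g(z^0;Z))$; uniqueness of $\nabla^2_{\mathrm{MFN}}g(z^0;Z)$ means that all minimizers share the same second component. The set of all first components of elements of $\mathcal{M}_{\mathrm{MFN}}^{z^0,Z}$ is denoted $\mathcal{G}_{\mathrm{MFN}}^{z^0,Z}$ (it need not be a singleton). The MFN model corresponding to such a pair is $$m_{\mathrm{MFN}}^{z^0,Z}(z)=g(z^0)+\nabla_{\mathrm{MFN}}g(z^0;Z)^\top(z-z^0)+\tfrac12(z-z^0)^\top\nabla^2_{\mathrm{MFN}}g(z^0;Z)(z-z^0).$$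 In the claim, the full-space objects ($m_{\mathrm{MFN}}^{x^0,Y}$, $\mathcal{G}_{\mathrm{MFN}}^{x^0,Y}$, etc.) are obtained with $k=n$, $g=f$, $z^0=x^0$, $Z=Y$, $u^i=d^i$, and the subspace objects ($\widehat{m}_{\mathrm{MFN}}^{0,\widehat{Y}}$, $\mathcal{G}_{\mathrm{MFN}}^{0,\widehat{Y}}$, etc.) with $k=d$, $g=\widehat{f}$, $z^0=0$, $Z=\widehat{Y}$, $u^i=\widehat{d}^i$. *)

theory Defs
  imports "HOL-Analysis.Analysis" "HOL-Library.Set_Algebras"
begin

text \<open>The library norm on \<^typ>\<open>real^'k^'k\<close> is the Frobenius norm.\<close>

lemma norm_matrix_eq_Frobenius:
  fixes A :: "real^'k^'l"
  shows "norm A = sqrt (\<Sum>i\<in>UNIV. \<Sum>j\<in>UNIV. (A $ i $ j)\<^sup>2)"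
  by (simp add: norm_vec_def L2_set_def sum_nonneg)

definition quadratic_function :: "(real^'k \<Rightarrow> real) \<Rightarrow> bool" where
  "quadratic_function q \<longleftrightarrow>
     (\<exists>(c::real) (b::'k \<Rightarrow> real) (a::'k \<Rightarrow> 'k \<Rightarrow> real).
        \<forall>x. q x = c + (\<Sum>i\<in>UNIV. b i * x $ i)
                    + (\<Sum>i\<in>UNIV. \<Sum>j\<in>UNIV. a i j * x $ i * x $ j))"

definition orthonormal_columns :: "real^'d^'n \<Rightarrow> bool" where
  "orthonormal_columns Q \<longleftrightarrow>
     (\<forall>i j. column i Q \<bullet> column j Q = (if i = j then 1 else 0))"

definition col_perp :: "real^'d^'n \<Rightarrow> (real^'n) set" where
  "col_perp Q = orthogonal_comp (span (columns Q))"

text \<open>The displacements \<open>u\<close> are indexed by \<open>{1..m}\<close>; values of \<open>u\<close> outside this range are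
  irrelevant. The displacements need not be distinct or nonzero.\<close>

definition sample_set :: "real^'k \<Rightarrow> nat \<Rightarrow> (nat \<Rightarrow> real^'k) \<Rightarrow> (real^'k) set" where
  "sample_set z0 m u = {z0} \<union> {z0 + u i | i. i \<in> {1..m}}"

definition mfn_feasible ::
  "(real^'k \<Rightarrow> real) \<Rightarrow> real^'k \<Rightarrow> nat \<Rightarrow> (nat \<Rightarrow> real^'k) \<Rightarrow> ((real^'k) \<times> (real^'k^'k)) \<Rightarrow> bool" where
  "mfn_feasible g z0 m u = (\<lambda>(\<alpha>, H). transpose H = H \<and>
     (\<forall>i\<in>{1..m}. u i \<bullet> \<alpha> + 1/2 * (u i \<bullet> (H *v u i)) = g (z0 + u i) - g z0))"

definition mfn_minimizers ::
  "(real^'k \<Rightarrow> real) \<Rightarrow> real^'k \<Rightarrow> nat \<Rightarrow> (nat \<Rightarrow> real^'k) \<Rightarrow> ((real^'k) \<times> (real^'k^'k)) set" where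
  "mfn_minimizers g z0 m u =
     {p. is_arg_min (\<lambda>(\<alpha>, H). 1/2 * (norm H)\<^sup>2) (mfn_feasible g z0 m u) p}"

definition mfn_gradients ::
  "(real^'k \<Rightarrow> real) \<Rightarrow> real^'k \<Rightarrow> nat \<Rightarrow> (nat \<Rightarrow> real^'k) \<Rightarrow> (real^'k) set" where
  "mfn_gradients g z0 m u = fst ` mfn_minimizers g z0 m u"

definition mfn_hessians ::
  "(real^'k \<Rightarrow> real) \<Rightarrow> real^'k \<Rightarrow> nat \<Rightarrow> (nat \<Rightarrow> real^'k) \<Rightarrow> (real^'k^'k) set" where
  "mfn_hessians g z0 m u = snd ` mfn_minimizers g z0 m u"

text \<open>The model determined by \<open>g\<close>, \<open>z0\<close> and a pair \<open>(\<alpha>, H)\<close>; it is an MFN model when the pair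
  belongs to \<^const>\<open>mfn_minimizers\<close>.\<close>

definition mfn_model ::
  "(real^'k \<Rightarrow> real) \<Rightarrow> real^'k \<Rightarrow> (real^'k) \<times> (real^'k^'k) \<Rightarrow> real^'k \<Rightarrow> real" where
  "mfn_model g z0 = (\<lambda>(\<alpha>, H) z.
     g z0 + \<alpha> \<bullet> (z - z0) + 1/2 * ((z - z0) \<bullet> (H *v (z - z0))))"

end

theory Submission
  imports Defs
begin

text \<open>The admissible Hessians form a nonempty affine, hence closed and convex, set, so there is
  exactly one of least norm. Conjugation \<open>H \<mapsto> Q\<^sup>T H Q\<close> maps the full-space feasible set
  to the subspace one, \<open>K \<mapsto> Q K Q\<^sup>T\<close> maps back, and neither increases the Frobenius norm;
  so the two transport minimizers to minimizers, and uniqueness identifies the Hessians.\<close>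

section \<open>Existence and uniqueness of the least-norm Hessian\<close>

lemma mem_mfn_minimizers_iff:
  "(\<alpha>, H) \<in> mfn_minimizers g z0 m u \<longleftrightarrow>
     mfn_feasible g z0 m u (\<alpha>, H) \<and> (\<forall>\<beta> K. mfn_feasible g z0 m u (\<beta>, K) \<longrightarrow> norm H \<le> norm K)"
  by (auto simp: mfn_minimizers_def is_arg_min_linorder power2_le_iff_abs_le)

lemma transpose_linear_combination:
  fixes A B :: "real^'n^'m"
  shows "transpose (s *\<^sub>R A + t *\<^sub>R B) = s *\<^sub>R transpose A + t *\<^sub>R transpose B"
  by (simp add: transpose_def vec_eq_iff)

text \<open>The constraints are linear in the pair jointly. Negative weights are allowed, so the
  feasible set is affine and not merely convex; this later yields closedness for free in finite
  dimension.\<close>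

lemma mfn_feasible_affine_combination:
  assumes "mfn_feasible g z0 m u (\<alpha>, H)" and "mfn_feasible g z0 m u (\<beta>, K)" and "s + t = 1"
  shows "mfn_feasible g z0 m u (s *\<^sub>R \<alpha> + t *\<^sub>R \<beta>, s *\<^sub>R H + t *\<^sub>R K)"
proof -
  have "u i \<bullet> (s *\<^sub>R \<alpha> + t *\<^sub>R \<beta>) + 1/2 * (u i \<bullet> ((s *\<^sub>R H + t *\<^sub>R K) *v u i)) = g (z0 + u i) - g z0"
    if i: "i \<in> {1..m}" for i
  proof -
    have "u i \<bullet> (s *\<^sub>R \<alpha> + t *\<^sub>R \<beta>) + 1/2 * (u i \<bullet> ((s *\<^sub>R H + t *\<^sub>R K) *v u i))
      = s * (u i \<bullet> \<alpha> + 1/2 * (u i \<bullet> (H *v u i))) + t * (u i \<bullet> \<beta> + 1/2 * (u i \<bullet> (K *v u i)))"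
      by (simp add: matrix_vector_mult_add_rdistrib scaleR_matrix_vector_assoc[symmetric]
          inner_add_right algebra_simps)
    also have "\<dots> = (s + t) * (g (z0 + u i) - g z0)"
      using assms(1,2) i by (simp add: mfn_feasible_def distrib_right)
    finally show ?thesis
      using assms(3) by simp
  qed
  then show ?thesis
    using assms(1,2) by (simp add: mfn_feasible_def transpose_linear_combination)
qed

lemma mfn_hessian_exists_unique:
  assumes "mfn_feasible g z0 m u p"
  shows "\<exists>!H. H \<in> mfn_hessians g z0 m u"
proof -
  \<comment> \<open>The objective ignores \<alpha>, so the problem reduces to finding the point
    nearest to 0 in the projection of the feasible set to its second component.\<close>
  define S where "S = {H. \<exists>\<alpha>. mfn_feasible g z0 m u (\<alpha>, H)}"
  have "affine S"
    unfolding affine_def S_def using mfn_feasible_affine_combination by blast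
  then have S: "closed S" "convex S"
    by (auto simp: affine_closed affine_imp_convex)
  have "S \<noteq> {}"
    using assms by (cases p) (auto simp: S_def)
  then obtain H where H: "H \<in> S" "\<And>K. K \<in> S \<Longrightarrow> norm H \<le> norm K"
    using closest_point_exists[OF S(1), of 0] by (metis dist_0_norm)
  have mem: "K \<in> mfn_hessians g z0 m u \<longleftrightarrow> K \<in> S \<and> (\<forall>L\<in>S. norm K \<le> norm L)" for K
    by (auto simp: mfn_hessians_def S_def mem_mfn_minimizers_iff image_iff Bex_def)
  show ?thesis
  proof
    show "H \<in> mfn_hessians g z0 m u"
      using H mem by blast
    show "K = H" if "K \<in> mfn_hessians g z0 m u" for K
      using any_closest_point_unique[OF S(2,1), of K H 0] that H mem by auto
  qed
qed

text \<open>Keeps products in the form \<open>transpose M *v w\<close>, in which moving M across an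
  inner product is expressed below.\<close>

declare transpose_matrix_vector [simp del]

lemma inner_matrix_vector_transpose:
  fixes M :: "real^'n^'m"
  shows "(M *v v) \<bullet> w = v \<bullet> (transpose M *v w)"
  by (metis dot_lmul_matrix inner_commute transpose_matrix_vector)

text \<open>This is the exact Taylor expansion of q at z. Applied to an interpolating quadratic, it
  supplies a feasible pair.\<close>

lemma quadratic_function_expansion:
  fixes q :: "real^'k \<Rightarrow> real"
  assumes "quadratic_function q"
  obtains \<alpha> H where "transpose H = H"
    and "\<And>u. u \<bullet> \<alpha> + 1/2 * (u \<bullet> (H *v u)) = q (z + u) - q z"
proof -
  from assms obtain c b a where q: "\<And>x. q x = c + (\<Sum>i\<in>UNIV. b i * x $ i)
      + (\<Sum>i\<in>UNIV. \<Sum>j\<in>UNIV. a i j * x $ i * x $ j)"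
    unfolding quadratic_function_def by blast
  define B :: "real^'k" where "B = (\<chi> i. b i)"
  define A :: "real^'k^'k" where "A = (\<chi> i j. a i j)"
  have q': "q x = c + B \<bullet> x + x \<bullet> (A *v x)" for x
    by (simp add: q B_def A_def inner_vec_def matrix_vector_mult_def sum_distrib_left mult_ac)
  \<comment> \<open>The coefficient matrix A may be non-symmetric; its symmetrization, without a
    factor 1/2, is the Hessian of q, and \<open>B + H *v z\<close> is the gradient at z.\<close>
  define H where "H = A + transpose A"
  have tA: "x \<bullet> (transpose A *v y) = y \<bullet> (A *v x)" for x y
    by (metis inner_commute inner_matrix_vector_transpose)
  show thesis
  proof
    show "transpose H = H"
      by (simp add: H_def transpose_def vec_eq_iff add.commute)
    show "u \<bullet> (B + H *v z) + 1/2 * (u \<bullet> (H *v u)) = q (z + u) - q z" for u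
      by (simp add: q' H_def matrix_vector_mult_add_rdistrib matrix_vector_right_distrib
          inner_add_right inner_add_left tA inner_commute[of u B])
  qed
qed

section \<open>Contractions and the Frobenius norm\<close>

lemma norm_transpose: "norm (transpose A) = norm A" for A :: "real^'n^'m"
  unfolding norm_matrix_eq_Frobenius by (subst sum.swap) (simp add: transpose_def)

text \<open>M acts on each column of A separately, and the Frobenius norm is the Euclidean norm of
  the vector of column norms. Transposing turns columns into the rows over which the library norm is
  taken.\<close>

lemma norm_matrix_mult_contraction:
  fixes M :: "real^'n^'m" and A :: "real^'k^'n"
  assumes "\<And>v. norm (M *v v) \<le> norm v"
  shows "norm (M ** A) \<le> norm A"
proof -
  have row: "transpose (M ** A) $ j = M *v (transpose A $ j)" for j
    by (simp add: vec_eq_iff transpose_def matrix_matrix_mult_def matrix_vector_mult_def)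
  have "norm (transpose (M ** A)) \<le> norm (transpose A)"
    unfolding norm_vec_def[of "transpose (M ** A)"] norm_vec_def[of "transpose A"] row
    by (intro L2_set_mono assms norm_ge_zero)
  then show ?thesis
    by (simp add: norm_transpose)
qed

text \<open>Transposition preserves the norm and moves the right factor to the left, so the
  one-sided bound applies twice.\<close>

lemma norm_matrix_conjugate_contraction:
  fixes M :: "real^'n^'m" and A :: "real^'n^'n"
  assumes "\<And>v. norm (M *v v) \<le> norm v"
  shows "norm (M ** A ** transpose M) \<le> norm A"
proof -
  have "norm (M ** A ** transpose M) = norm (M ** transpose (M ** A))"
    by (metis matrix_transpose_mul norm_transpose transpose_transpose)
  also have "\<dots> \<le> norm (M ** A)"
    using norm_matrix_mult_contraction[OF assms, of "transpose (M ** A)"]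
    by (simp add: norm_transpose)
  also have "\<dots> \<le> norm A"
    by (rule norm_matrix_mult_contraction[OF assms])
  finally show ?thesis .
qed

section \<open>Matrices with orthonormal columns\<close>

lemma orthonormal_columns_transpose_mult:
  "orthonormal_columns Q \<Longrightarrow> transpose Q ** Q = mat 1"
  by (simp add: orthonormal_columns_def vec_eq_iff matrix_mult_transpose_dot_column mat_def)

lemma orthonormal_columns_norm:
  assumes "orthonormal_columns Q"
  shows "norm (Q *v v) = norm v"
proof -
  have "(Q *v v) \<bullet> (Q *v v) = v \<bullet> ((transpose Q ** Q) *v v)"
    by (simp add: inner_matrix_vector_transpose matrix_vector_mul_assoc)
  then show ?thesis
    by (simp add: orthonormal_columns_transpose_mult[OF assms] norm_eq_sqrt_inner)
qed

text \<open>Bessel's inequality: Cauchy-Schwarz and the isometry of Q bound the square by the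
  product of both norms, and one factor cancels unless it is zero.\<close>

lemma orthonormal_columns_norm_transpose:
  assumes "orthonormal_columns Q"
  shows "norm (transpose Q *v w) \<le> norm w"
proof -
  have "(norm (transpose Q *v w))\<^sup>2 = (Q *v (transpose Q *v w)) \<bullet> w"
    by (simp add: inner_matrix_vector_transpose power2_norm_eq_inner)
  also have "\<dots> \<le> norm (transpose Q *v w) * norm w"
    by (metis norm_cauchy_schwarz orthonormal_columns_norm[OF assms])
  finally show ?thesis
    by (cases "norm (transpose Q *v w) = 0") (auto simp: power2_eq_square)
qed

lemma mem_col_perp_iff: "w \<in> col_perp Q \<longleftrightarrow> transpose Q *v w = 0"
proof
  assume "w \<in> col_perp Q"
  then have "column i Q \<bullet> w = 0" for i
    unfolding col_perp_def orthogonal_comp_def orthogonal_def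
    by (auto intro!: span_base simp: columns_def)
  then show "transpose Q *v w = 0"
    by (simp add: vec_eq_iff matrix_vector_mul_component transpose_def column_def)
next
  assume 0: "transpose Q *v w = 0"
  have "orthogonal w y" if "y \<in> span (columns Q)" for y
  proof (rule orthogonal_to_span[OF that])
    fix y assume "y \<in> columns Q"
    then obtain i where "y = Q *v axis i 1"
      by (auto simp: columns_def matrix_vector_mult_basis)
    then show "orthogonal w y"
      by (simp add: orthogonal_def inner_commute[of w] inner_matrix_vector_transpose 0)
  qed
  then show "w \<in> col_perp Q"
    by (simp add: col_perp_def orthogonal_comp_def orthogonal_commute)
qed

lemma transpose_conjugate:
  fixes M :: "real^'n^'m" and H :: "real^'n^'n"
  shows "transpose H = H \<Longrightarrow> transpose (M ** H ** transpose M) = M ** H ** transpose M"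
  by (simp add: matrix_transpose_mul matrix_mul_assoc)

text \<open>Used with M = Q to lift Hessians to the full space and with M =
  \<open>transpose Q\<close> to restrict them.\<close>

lemma inner_conjugate:
  fixes M :: "real^'n^'m" and H :: "real^'n^'n"
  shows "v \<bullet> ((M ** H ** transpose M) *v v) = (transpose M *v v) \<bullet> (H *v (transpose M *v v))"
  using inner_matrix_vector_transpose[of "transpose M" v]
  by (simp add: matrix_vector_mul_assoc[symmetric])

section \<open>Transport between the full space and the subspace\<close>

context
  fixes f :: "real^'n \<Rightarrow> real" and x0 :: "real^'n" and m :: nat
    and Q :: "real^'d^'n" and dd :: "nat \<Rightarrow> real^'n" and dhat :: "nat \<Rightarrow> real^'d"
    and fhat :: "real^'d \<Rightarrow> real"
  assumes Q: "orthonormal_columns Q"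
    and dhat: "\<And>i. i \<in> {1..m} \<Longrightarrow> dd i = Q *v dhat i"
    and fhat: "\<And>xhat. fhat xhat = f (x0 + Q *v xhat)"
begin

lemma transpose_Q_mult: "transpose Q *v (Q *v v) = v"
  by (simp add: matrix_vector_mul_assoc orthonormal_columns_transpose_mult[OF Q])

text \<open>Since each displacement is Q applied to its subspace counterpart, moving Q across the
  inner products turns each full-space constraint into the matching subspace one.\<close>

lemma mfn_feasible_restrict:
  assumes "mfn_feasible f x0 m dd (\<alpha>, H)"
  shows "mfn_feasible fhat 0 m dhat (transpose Q *v \<alpha>, transpose Q ** H ** Q)"
  using assms dhat transpose_conjugate[of H "transpose Q"] inner_conjugate[of _ "transpose Q" H]
  by (auto simp: mfn_feasible_def fhat inner_matrix_vector_transpose[of Q, symmetric])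

text \<open>The displacements lie in the column space, so w contributes nothing to any constraint,
  and \<open>transpose Q ** Q\<close> being the identity recovers the subspace terms.\<close>

lemma mfn_feasible_lift:
  assumes "mfn_feasible fhat 0 m dhat (\<alpha>, H)" and "w \<in> col_perp Q"
  shows "mfn_feasible f x0 m dd (Q *v \<alpha> + w, Q ** H ** transpose Q)"
proof -
  have "(Q *v v) \<bullet> (Q *v \<alpha> + w) = v \<bullet> \<alpha>" for v
    using assms(2) by (simp add: inner_matrix_vector_transpose mem_col_perp_iff
        matrix_vector_right_distrib transpose_Q_mult)
  then show ?thesis
    using assms(1) dhat
    by (simp add: mfn_feasible_def fhat transpose_conjugate inner_conjugate transpose_Q_mult)
qed

text \<open>Any full-space competitor K is compared through its restriction: lifting does not
  increase the norm of H, H is optimal in the subspace, and restricting does not increase the norm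
  of K.\<close>

lemma mfn_minimizers_lift:
  assumes min: "(\<alpha>, H) \<in> mfn_minimizers fhat 0 m dhat" and w: "w \<in> col_perp Q"
  shows "(Q *v \<alpha> + w, Q ** H ** transpose Q) \<in> mfn_minimizers f x0 m dd"
proof -
  have "norm (Q ** H ** transpose Q) \<le> norm K" if "mfn_feasible f x0 m dd (\<beta>, K)" for \<beta> K
  proof -
    have "norm (Q ** H ** transpose Q) \<le> norm H"
      by (intro norm_matrix_conjugate_contraction) (simp add: orthonormal_columns_norm[OF Q])
    also have "\<dots> \<le> norm (transpose Q ** K ** Q)"
      using min mfn_feasible_restrict[OF that] by (simp add: mem_mfn_minimizers_iff)
    also have "\<dots> \<le> norm K"
      using norm_matrix_conjugate_contraction[OF orthonormal_columns_norm_transpose[OF Q], of K]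
      by simp
    finally show ?thesis .
  qed
  then show ?thesis
    using min mfn_feasible_lift[OF _ w] by (simp add: mem_mfn_minimizers_iff)
qed

context
  assumes feasible: "\<exists>p. mfn_feasible f x0 m dd p"
begin

lemma mfn_hessian_unique: "\<exists>!H. H \<in> mfn_hessians f x0 m dd"
  using feasible mfn_hessian_exists_unique by blast

lemma mfn_hessian_subspace_unique: "\<exists>!H. H \<in> mfn_hessians fhat 0 m dhat"
  using feasible mfn_hessian_exists_unique mfn_feasible_restrict by (metis surj_pair)

text \<open>Lifting a subspace minimizer with w = 0 gives a full-space minimizer, whose Hessian must
  be the unique one.\<close>

lemma mfn_hessian_eq:
  assumes "H \<in> mfn_hessians f x0 m dd" and "Hhat \<in> mfn_hessians fhat 0 m dhat"
  shows "H = Q ** Hhat ** transpose Q"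
proof -
  obtain \<alpha> where "(\<alpha>, Hhat) \<in> mfn_minimizers fhat 0 m dhat"
    using assms(2) by (auto simp: mfn_hessians_def)
  then have "(Q *v \<alpha> + 0, Q ** Hhat ** transpose Q) \<in> mfn_minimizers f x0 m dd"
    by (rule mfn_minimizers_lift) (simp add: mem_col_perp_iff)
  then have "Q ** Hhat ** transpose Q \<in> mfn_hessians f x0 m dd"
    by (force simp: mfn_hessians_def)
  then show ?thesis
    using assms(1) mfn_hessian_unique by blast
qed

text \<open>Restriction preserves feasibility, and it sends the full-space Hessian back to the
  optimal subspace Hessian, so the restricted pair attains the minimum.\<close>

lemma mfn_minimizers_restrict:
  assumes min: "(\<alpha>, H) \<in> mfn_minimizers f x0 m dd"
  shows "(transpose Q *v \<alpha>, transpose Q ** H ** Q) \<in> mfn_minimizers fhat 0 m dhat"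
proof -
  obtain Hhat where Hhat: "Hhat \<in> mfn_hessians fhat 0 m dhat"
    using mfn_hessian_subspace_unique by blast
  have "H \<in> mfn_hessians f x0 m dd"
    using min by (force simp: mfn_hessians_def)
  then have "H = Q ** Hhat ** transpose Q"
    using mfn_hessian_eq Hhat by blast
  then have "transpose Q ** H ** Q = (transpose Q ** Q) ** Hhat ** (transpose Q ** Q)"
    by (simp add: matrix_mul_assoc)
  then have "transpose Q ** H ** Q = Hhat"
    by (simp add: orthonormal_columns_transpose_mult[OF Q])
  moreover have "mfn_feasible fhat 0 m dhat (transpose Q *v \<alpha>, transpose Q ** H ** Q)"
    using min mfn_feasible_restrict by (simp add: mem_mfn_minimizers_iff)
  ultimately show ?thesis
    using Hhat by (auto simp: mfn_hessians_def mem_mfn_minimizers_iff)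
qed

lemma mfn_gradients_eq:
  "mfn_gradients f x0 m dd = {Q *v \<alpha> | \<alpha>. \<alpha> \<in> mfn_gradients fhat 0 m dhat} + col_perp Q"
proof (intro equalityI subsetI)
  fix \<alpha> assume "\<alpha> \<in> mfn_gradients f x0 m dd"
  then have "transpose Q *v \<alpha> \<in> mfn_gradients fhat 0 m dhat"
    using mfn_minimizers_restrict by (force simp: mfn_gradients_def)
  \<comment> \<open>The vector \<open>Q *v (transpose Q *v \<alpha>)\<close> is the orthogonal
    projection of \<alpha> onto the column space; this is the remainder.\<close>
  moreover have "\<alpha> - Q *v (transpose Q *v \<alpha>) \<in> col_perp Q"
    by (simp add: mem_col_perp_iff matrix_vector_mult_diff_distrib transpose_Q_mult)
  moreover have "\<alpha> = Q *v (transpose Q *v \<alpha>) + (\<alpha> - Q *v (transpose Q *v \<alpha>))"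
    by simp
  ultimately show "\<alpha> \<in> {Q *v \<alpha> | \<alpha>. \<alpha> \<in> mfn_gradients fhat 0 m dhat} + col_perp Q"
    unfolding set_plus_def by blast
next
  fix \<alpha> assume "\<alpha> \<in> {Q *v \<alpha> | \<alpha>. \<alpha> \<in> mfn_gradients fhat 0 m dhat} + col_perp Q"
  then show "\<alpha> \<in> mfn_gradients f x0 m dd"
    using mfn_minimizers_lift by (force simp: mfn_gradients_def set_plus_def)
qed

text \<open>Common core of both model identities: the relation between the Hessians matches the
  quadratic terms, while the linear terms agree for a different reason in each case and are left as
  a premise.\<close>

lemma mfn_model_eq:
  assumes "(\<alpha>, H) \<in> mfn_minimizers f x0 m dd"
    and "(\<alpha>hat, Hhat) \<in> mfn_minimizers fhat 0 m dhat"
    and "transpose Q *v (x - x0) = xhat"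
    and "\<alpha> \<bullet> (x - x0) = \<alpha>hat \<bullet> xhat"
  shows "mfn_model f x0 (\<alpha>, H) x = mfn_model fhat 0 (\<alpha>hat, Hhat) xhat"
proof -
  have "H = Q ** Hhat ** transpose Q"
    using assms(1,2) by (intro mfn_hessian_eq) (force simp: mfn_hessians_def)+
  then show ?thesis
    using assms(3,4) by (simp add: mfn_model_def inner_conjugate fhat)
qed

end

end

theorem theorem2:
  fixes f :: "real^'n \<Rightarrow> real" and x0 :: "real^'n"
    and m :: nat and dd :: "nat \<Rightarrow> real^'n" and Y :: "(real^'n) set"
    and Q :: "real^'d^'n" and dhat :: "nat \<Rightarrow> real^'d" and fhat :: "real^'d \<Rightarrow> real"
  assumes Y: "Y = sample_set x0 m dd"
    and dim: "CARD('d) < CARD('n)"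
    and Q: "orthonormal_columns Q"
    and subspace: "Y \<subseteq> {x0 + Q *v xhat | xhat. True}"
    and interp: "\<exists>q. quadratic_function q \<and> (\<forall>y\<in>Y. q y = f y)"
    and dhat: "\<forall>i\<in>{1..m}. dd i = Q *v dhat i"
    and fhat: "\<forall>xhat. fhat xhat = f (x0 + Q *v xhat)"
  shows
    "(\<exists>!H. H \<in> mfn_hessians f x0 m dd) \<and>
     (\<exists>!Hhat. Hhat \<in> mfn_hessians fhat 0 m dhat) \<and>
     (\<forall>H \<in> mfn_hessians f x0 m dd. \<forall>Hhat \<in> mfn_hessians fhat 0 m dhat.
        H = Q ** Hhat ** transpose Q)
     \<and>
     mfn_gradients f x0 m dd = {Q *v \<alpha> | \<alpha>. \<alpha> \<in> mfn_gradients fhat 0 m dhat} + col_perp Q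
     \<and>
     (\<forall>\<alpha> H \<alpha>hat Hhat.
        (\<alpha>, H) \<in> mfn_minimizers f x0 m dd \<longrightarrow>
        (\<alpha>hat, Hhat) \<in> mfn_minimizers fhat 0 m dhat \<longrightarrow>
        \<alpha> - Q *v \<alpha>hat \<in> col_perp Q \<longrightarrow>
        (\<forall>x xhat. x = x0 + Q *v xhat \<longrightarrow>
           mfn_model f x0 (\<alpha>, H) x = mfn_model fhat 0 (\<alpha>hat, Hhat) xhat))
     \<and>
     (\<forall>\<alpha> H \<alpha>hat Hhat.
        (\<alpha>, H) \<in> mfn_minimizers f x0 m dd \<longrightarrow>
        (\<alpha>hat, Hhat) \<in> mfn_minimizers fhat 0 m dhat \<longrightarrow>
        \<alpha> = Q *v \<alpha>hat \<longrightarrow>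
        (\<forall>x xhat. x \<in> {x0 + Q *v xhat} + col_perp Q \<longrightarrow>
           mfn_model f x0 (\<alpha>, H) x = mfn_model fhat 0 (\<alpha>hat, Hhat) xhat))"
proof -
  have dhat': "dd i = Q *v dhat i" if "i \<in> {1..m}" for i
    using dhat that by blast
  have fhat': "fhat xhat = f (x0 + Q *v xhat)" for xhat
    using fhat by blast
  obtain q where q: "quadratic_function q" "\<And>y. y \<in> Y \<Longrightarrow> q y = f y"
    using interp by blast
  \<comment> \<open>The interpolating quadratic shows that the full-space constraints are
    consistent.\<close>
  obtain \<alpha>0 H0 where "transpose H0 = H0"
    and "\<And>u. u \<bullet> \<alpha>0 + 1/2 * (u \<bullet> (H0 *v u)) = q (x0 + u) - q x0"
    using quadratic_function_expansion[OF q(1), of x0] by blast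
  moreover have "q x0 = f x0" and "\<And>i. i \<in> {1..m} \<Longrightarrow> q (x0 + dd i) = f (x0 + dd i)"
    by (intro q(2); auto simp: Y sample_set_def)+
  ultimately have "mfn_feasible f x0 m dd (\<alpha>0, H0)"
    by (simp add: mfn_feasible_def)
  then have feas: "\<exists>p. mfn_feasible f x0 m dd p" ..
  note ctx = Q dhat' fhat' feas
  have model_on: "mfn_model f x0 (\<alpha>, H) x = mfn_model fhat 0 (\<alpha>hat, Hhat) xhat"
    if min: "(\<alpha>, H) \<in> mfn_minimizers f x0 m dd" "(\<alpha>hat, Hhat) \<in> mfn_minimizers fhat 0 m dhat"
      and perp: "\<alpha> - Q *v \<alpha>hat \<in> col_perp Q" and x: "x = x0 + Q *v xhat"
    for \<alpha> H \<alpha>hat Hhat x xhat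
  proof (rule mfn_model_eq[OF ctx min])
    show "transpose Q *v (x - x0) = xhat"
      by (simp add: x transpose_Q_mult[OF Q])
    \<comment> \<open>Applying \<open>transpose Q\<close> removes the orthogonal part of \<alpha>,
      which therefore cannot affect displacements in the column space.\<close>
    have "transpose Q *v \<alpha> = \<alpha>hat"
      using perp by (simp add: mem_col_perp_iff matrix_vector_mult_diff_distrib transpose_Q_mult[OF Q])
    then show "\<alpha> \<bullet> (x - x0) = \<alpha>hat \<bullet> xhat"
      by (simp add: x inner_commute[of \<alpha>] inner_matrix_vector_transpose inner_commute[of xhat])
  qed
  have model_off: "mfn_model f x0 (\<alpha>, H) x = mfn_model fhat 0 (\<alpha>hat, Hhat) xhat"
    if min: "(\<alpha>, H) \<in> mfn_minimizers f x0 m dd" "(\<alpha>hat, Hhat) \<in> mfn_minimizers fhat 0 m dhat"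
      and \<alpha>: "\<alpha> = Q *v \<alpha>hat" and x: "x \<in> {x0 + Q *v xhat} + col_perp Q"
    for \<alpha> H \<alpha>hat Hhat x xhat
  proof (rule mfn_model_eq[OF ctx min])
    obtain w where w: "transpose Q *v w = 0" and xw: "x = x0 + Q *v xhat + w"
      using x by (auto simp: set_plus_def mem_col_perp_iff)
    \<comment> \<open>The point may now leave the affine space by w, but \<open>transpose Q\<close>
      annihilates w; as \<alpha> lies in the column space, the linear term does not see w
      either.\<close>
    have "transpose Q *v (Q *v xhat + w) = xhat"
      by (simp add: w matrix_vector_right_distrib transpose_Q_mult[OF Q])
    then show *: "transpose Q *v (x - x0) = xhat"
      by (simp add: xw add.assoc)
    show "\<alpha> \<bullet> (x - x0) = \<alpha>hat \<bullet> xhat"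
      by (simp add: \<alpha> inner_matrix_vector_transpose *)
  qed
  show ?thesis
    using mfn_hessian_unique[OF ctx] mfn_hessian_subspace_unique[OF ctx] mfn_hessian_eq[OF ctx]
      mfn_gradients_eq[OF ctx] model_on model_off
    by (intro conjI ballI allI impI) simp_all
qed

end
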